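(* For $N\in\mathbb{N}$ let $\#(N)$ denote the number of families $\mathcal{B}\subseteq\mathcal{P}(S)$ that are topological bases on a set $S$ with $|S|=N$. Then $$\#(0)=2,\qquad \#(1)=2,\qquad \#(2)=10,\qquad \#(3)=142.$$
   Context: A family $\mathcal{B}\subseteq\mathcal{P}(S)$ is a topological basis on $S$ if (1) $\bigcup_{B\in\mathcal{B}}B=S$, and (2) for all $B_1,B_2\in\mathcal{B}$ and all $x\in B_1\cap B_2$ there is $B_3\in\mathcal{B}$ with $x\in B_3\subseteq B_1\cap B_2$. The empty set is allowed, but not required, to be a member of $\mathcal{B}$; for $S=\emptyset$ both $\mathcal{B}=\emptyset$ and $\mathcal{B}=\{\emptyset\}$ count as bases. *)

theory Defs
  imports Main
begin

(* The predicate topological_basis of HOL-Analysis concerns a basis of the topology already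
   carried by a type of class topological_space; here a family on an arbitrary carrier set S
   is a basis without reference to a given topology. *)
definition topological_basis_on :: "'a set \<Rightarrow> 'a set set \<Rightarrow> bool" where
  "topological_basis_on S \<B> \<longleftrightarrow>
     \<B> \<subseteq> Pow S \<and>
     \<Union>\<B> = S \<and>
     (\<forall>B1\<in>\<B>. \<forall>B2\<in>\<B>. \<forall>x\<in>B1 \<inter> B2. \<exists>B3\<in>\<B>. x \<in> B3 \<and> B3 \<subseteq> B1 \<inter> B2)"

definition num_topological_bases :: "'a set \<Rightarrow> nat" where
  "num_topological_bases S = card {\<B>. topological_basis_on S \<B>}"

end

theory Submission
  imports Defs
begin

text \<open>A bijection of the underlying sets carries bases to bases, so for finite
  \<open>S\<close> the count depends only on \<open>card S\<close>
  (\<open>num_topological_bases_cong\<close>). It is therefore enough to treat the sets {}, {0}, {0,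
  1} and {0, 1, 2} of naturals. Their power sets have 1, 2, 4 and 8 members, which leaves 2, 4, 16
  and 256 candidate families. Taking \<open>subseqs\<close> twice lists every family exactly once,
  and \<open>num_topological_bases_set\<close> turns the count into the length of a filtered list,
  which is then evaluated.\<close>

lemma topological_basis_on_image:
  assumes f: "bij_betw f S T" and B: "topological_basis_on S \<B>"
  shows "topological_basis_on T ((`) f ` \<B>)"
  unfolding topological_basis_on_def
proof (intro conjI ballI)
  have sub: "\<And>A. A \<in> \<B> \<Longrightarrow> A \<subseteq> S" and cover: "\<Union>\<B> = S"
    and refine: "\<And>A A' x. A \<in> \<B> \<Longrightarrow> A' \<in> \<B> \<Longrightarrow> x \<in> A \<inter> A' \<Longrightarrow>
      \<exists>C\<in>\<B>. x \<in> C \<and> C \<subseteq> A \<inter> A'"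
    using B unfolding topological_basis_on_def by blast+
  have inj: "inj_on f S" and im: "f ` S = T"
    using f by (auto simp: bij_betw_def)
  show "(`) f ` \<B> \<subseteq> Pow T" using sub im by blast
  show "\<Union>((`) f ` \<B>) = T" using cover im by blast
  fix B1 B2 y
  assume "B1 \<in> (`) f ` \<B>" "B2 \<in> (`) f ` \<B>" and y: "y \<in> B1 \<inter> B2"
  then obtain A1 A2 where A: "A1 \<in> \<B>" "A2 \<in> \<B>" and eq: "B1 = f ` A1" "B2 = f ` A2"
    by blast
  \<comment> \<open>By injectivity, images commute with intersections, so \<open>y\<close> has a
    single preimage that lies in \<open>A1\<close> and \<open>A2\<close> at once; the basis property
    can be applied there.\<close>
  have int: "f ` (A1 \<inter> A2) = B1 \<inter> B2"
    using inj_on_image_Int[OF inj sub[OF A(1)] sub[OF A(2)]] eq by simp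
  with y obtain x where x: "x \<in> A1 \<inter> A2" "y = f x" by blast
  from refine[OF A x(1)] obtain C where C: "C \<in> \<B>" "x \<in> C" "C \<subseteq> A1 \<inter> A2" by blast
  have "y \<in> f ` C" using C(2) x(2) by simp
  moreover have "f ` C \<subseteq> B1 \<inter> B2" using image_mono[OF C(3), of f] int by simp
  ultimately show "\<exists>B3\<in>(`) f ` \<B>. y \<in> B3 \<and> B3 \<subseteq> B1 \<inter> B2"
    using C(1) by (intro bexI[of _ "f ` C"]) simp_all
qed

text \<open>Taking images under \<open>f\<close> injects the bases on \<open>S\<close> into those on
  \<open>T\<close>. The reverse inequality comes from the inverse bijection.\<close>

lemma num_topological_bases_mono:
  assumes f: "bij_betw f S T" and "finite T"
  shows "num_topological_bases S \<le> num_topological_bases T"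
  unfolding num_topological_bases_def
proof (rule card_inj_on_le)
  have "inj_on f S" using f by (simp add: bij_betw_def)
  \<comment> \<open>Injectivity is lifted twice: from points to subsets, then to families of
    subsets.\<close>
  then have "inj_on ((`) ((`) f)) (Pow (Pow S))"
    by (intro inj_on_image_Pow)
  then show "inj_on ((`) ((`) f)) {\<B>. topological_basis_on S \<B>}"
    by (rule inj_on_subset) (auto simp: topological_basis_on_def)
  show "(`) ((`) f) ` {\<B>. topological_basis_on S \<B>} \<subseteq> {\<B>. topological_basis_on T \<B>}"
    using topological_basis_on_image[OF f] by blast
  show "finite {\<B>. topological_basis_on T \<B>}"
    by (rule finite_subset[of _ "Pow (Pow T)"]) (auto simp: topological_basis_on_def assms)
qed

lemma num_topological_bases_cong:
  assumes "finite S" "finite T" "card S = card T"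
  shows "num_topological_bases S = num_topological_bases T"
proof -
  obtain f where f: "bij_betw f S T"
    using finite_same_card_bij[OF assms] by blast
  show ?thesis
    using num_topological_bases_mono[OF f \<open>finite T\<close>]
      num_topological_bases_mono[OF bij_betw_inv_into[OF f] \<open>finite S\<close>]
    by (rule antisym)
qed

lemma bij_betw_set_subseqs:
  assumes "distinct xs"
  shows "bij_betw set (set (subseqs xs)) (Pow (set xs))"
proof -
  have "distinct (map set (subseqs xs))"
    using assms by (rule distinct_set_subseqs)
  then show ?thesis
    by (simp add: bij_betw_def distinct_map subseqs_powset)
qed

text \<open>
  Each quantifier body is a constant applied partially: \<open>code_simp\<close> also rewrites below
  binders, and with \<open>\<lambda>\<close>-abstractions as bodies it would unfold the membership and
  inclusion tests symbolically, which does not finish in reasonable time.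
\<close>

definition is_nbhd_within :: "'a \<Rightarrow> 'a set \<Rightarrow> 'a set \<Rightarrow> bool" where
  "is_nbhd_within x C B \<longleftrightarrow> x \<in> B \<and> B \<subseteq> C"

definition has_nbhd_within :: "'a set set \<Rightarrow> 'a set \<Rightarrow> 'a \<Rightarrow> bool" where
  "has_nbhd_within \<B> C x \<longleftrightarrow> Bex \<B> (is_nbhd_within x C)"

definition inter_covered :: "'a set set \<Rightarrow> 'a set \<Rightarrow> 'a set \<Rightarrow> bool" where
  "inter_covered \<B> B1 B2 \<longleftrightarrow> Ball (B1 \<inter> B2) (has_nbhd_within \<B> (B1 \<inter> B2))"

definition inters_covered :: "'a set set \<Rightarrow> 'a set \<Rightarrow> bool" where
  "inters_covered \<B> B1 \<longleftrightarrow> Ball \<B> (inter_covered \<B> B1)"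

definition basis_test :: "'a set \<Rightarrow> 'a set list \<Rightarrow> bool" where
  "basis_test S Bs \<longleftrightarrow> S \<subseteq> \<Union>(set Bs) \<and> Ball (set Bs) (inters_covered (set Bs))"

text \<open>For a family of subsets of \<open>S\<close> the union lies in \<open>S\<close> anyway,
  so covering \<open>S\<close> is an inclusion. The enumerated candidates are families of subsets by
  construction, so filtering by \<open>basis_test\<close> selects exactly the bases.\<close>

lemma topological_basis_on_iff_basis_test:
  "topological_basis_on S (set Bs) \<longleftrightarrow> set Bs \<subseteq> Pow S \<and> basis_test S Bs"
proof -
  have "\<Union>(set Bs) = S \<longleftrightarrow> S \<subseteq> \<Union>(set Bs)" if "set Bs \<subseteq> Pow S"
    using that by blast
  then show ?thesis
    unfolding topological_basis_on_def basis_test_def inters_covered_def inter_covered_def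
      has_nbhd_within_def is_nbhd_within_def
    by (simp only: cong: conj_cong)
qed

lemma num_topological_bases_set:
  assumes "distinct xs"
  shows "num_topological_bases (set xs) =
    length (filter (basis_test (set xs)) (subseqs (map set (subseqs xs))))"
    (is "_ = length ?L")
proof -
  have d: "distinct (map set (subseqs xs))"
    using assms by (rule distinct_set_subseqs)
  have bij: "bij_betw set (set (subseqs (map set (subseqs xs)))) (Pow (Pow (set xs)))"
    using bij_betw_set_subseqs[OF d] by (simp add: subseqs_powset)
  have "set ` set ?L = {\<B>. topological_basis_on (set xs) \<B>}" (is "?A = ?C")
  proof (intro equalityI subsetI)
    fix \<B> assume "\<B> \<in> ?A"
    then show "\<B> \<in> ?C"
      using bij_betw_imp_surj_on[OF bij] by (auto simp: topological_basis_on_iff_basis_test)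
  next
    fix \<B> assume \<B>: "\<B> \<in> ?C"
    then have "\<B> \<in> Pow (Pow (set xs))" by (auto simp: topological_basis_on_def)
    then obtain Bs where "Bs \<in> set (subseqs (map set (subseqs xs)))" "\<B> = set Bs"
      using bij_betw_imp_surj_on[OF bij] by (metis imageE)
    with \<B> show "\<B> \<in> ?A" by (simp add: topological_basis_on_iff_basis_test)
  qed
  then have "num_topological_bases (set xs) = card (set ` set ?L)"
    by (simp only: num_topological_bases_def)
  \<comment> \<open>No family is counted twice: \<open>set\<close> is injective on the enumerated
    lists, and \<open>?L\<close> itself has no repetitions.\<close>
  also have "\<dots> = card (set ?L)"
    by (rule card_image, rule inj_on_subset[OF bij_betw_imp_inj_on[OF bij]]) auto
  also have "\<dots> = length ?L"
    using distinct_set_subseqs[OF d] by (intro distinct_card) (simp add: distinct_map)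
  finally show ?thesis .
qed

theorem mainTheorem3:
  fixes S :: "'a set"
  assumes "finite S"
  shows "(card S = 0 \<longrightarrow> num_topological_bases S = 2) \<and>
         (card S = 1 \<longrightarrow> num_topological_bases S = 2) \<and>
         (card S = 2 \<longrightarrow> num_topological_bases S = 10) \<and>
         (card S = 3 \<longrightarrow> num_topological_bases S = 142)"
proof -
  \<comment> \<open>The elements of \<open>S\<close> are abstract; passing to numerals gives a
    concrete set on which the test can be evaluated.\<close>
  have eq: "num_topological_bases S = num_topological_bases (set xs)"
    if "distinct xs" "card S = length xs" for xs :: "nat list"
    using that assms by (intro num_topological_bases_cong) (simp_all add: distinct_card)
  have "num_topological_bases (set ([] :: nat list)) = 2"
    \<comment> \<open>Both the length of the filtered list and the distinctness of the base list are
      settled by rewriting with code equations.\<close>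
    by (subst num_topological_bases_set) code_simp+
  moreover have "num_topological_bases (set [0 :: nat]) = 2"
    by (subst num_topological_bases_set) code_simp+
  moreover have "num_topological_bases (set [0, 1 :: nat]) = 10"
    by (subst num_topological_bases_set) code_simp+
  moreover have "num_topological_bases (set [0, 1, 2 :: nat]) = 142"
    by (subst num_topological_bases_set) code_simp+
  ultimately show ?thesis
    using eq[of "[]"] eq[of "[0]"] eq[of "[0, 1]"] eq[of "[0, 1, 2]"] by simp
qed

end
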